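(* Let $\sigma\in\{213,312\}$ and let $j^{\operatorname{des}}_{m,k}(\sigma)$ be the number of $\sigma$-avoiding Jacobi permutations $\pi\in\mathfrak{S}_m$ with $\operatorname{des}(\pi)=k$. Then \[ j^{\operatorname{des}}_{2n,k}(\sigma)=\frac{1}{n}\binom{n}{k-n}\binom{2n}{k+1}\quad\text{for all }n\geq1,\ k\geq0, \] \[ j^{\operatorname{des}}_{2n+1,k}(\sigma)=\frac{1}{n+1}\binom{n+1}{k-n}\binom{2n}{k}\quad\text{for all }n,k\geq0. \]
   Context: A permutation of a finite set $S$ of positive integers is a word in which each element of $S$ appears exactly once; $\mathfrak{S}_m$ is the set of permutations of $\{1,\dots,m\}$. For a permutation $\pi$ and a letter $x$ of $\pi$, $\rho_\pi(x)$ is the maximal consecutive subword of $\pi$ consisting of the letters immediately to the right of $x$ that are all larger than $x$. $\pi$ is Jacobi if $|\rho_\pi(x)|$ is even for all letters $x$. A permutation $\pi$ avoids a pattern $\sigma$ if no subword of $\pi$ has standardization (relative order) $\sigma$. A descent of $\pi\in\mathfrak{S}_m$ is an index $i\in[m-1]$ with $\pi_i>\pi_{i+1}$; $\operatorname{des}(\pi)$ is the number of descents. Binomial coefficients $\binom{a}{b}$ are $0$ when $b<0$ or $b>a$. *)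

theory Defs
  imports Complex_Main "HOL-Combinatorics.Multiset_Permutations" "HOL-Library.Sublist"
begin

definition rho :: "nat list \<Rightarrow> nat \<Rightarrow> nat list" where
  "rho \<pi> x = takeWhile (\<lambda>y. y > x) (tl (dropWhile (\<lambda>y. y \<noteq> x) \<pi>))"

definition jacobi :: "nat list \<Rightarrow> bool" where
  "jacobi \<pi> \<longleftrightarrow> (\<forall>x \<in> set \<pi>. even (length (rho \<pi> x)))"

definition standardize :: "nat list \<Rightarrow> nat list" where
  "standardize w = map (\<lambda>x. card {y \<in> set w. y \<le> x}) w"

text \<open>Pattern occurrences are arbitrary, not necessarily consecutive, subsequences.\<close>

definition avoids :: "nat list \<Rightarrow> nat list \<Rightarrow> bool" where
  "avoids \<pi> \<sigma> \<longleftrightarrow> \<not> (\<exists>w. subseq w \<pi> \<and> standardize w = \<sigma>)"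

text \<open>Lists are indexed from 0, so the \<open>i\<close>-th letter of \<open>\<pi>\<close> is \<open>\<pi> ! (i - 1)\<close>.\<close>

definition des :: "nat list \<Rightarrow> nat" where
  "des \<pi> = card {i \<in> {1..<length \<pi>}. \<pi> ! (i - 1) > \<pi> ! i}"

definition jdes :: "nat list \<Rightarrow> nat \<Rightarrow> nat \<Rightarrow> nat" where
  "jdes \<sigma> m k =
     card {\<pi> \<in> permutations_of_set {1..m}. jacobi \<pi> \<and> avoids \<pi> \<sigma> \<and> des \<pi> = k}"

text \<open>The lower index is an integer: with truncated subtraction on the naturals,
  \<open>n choose (k - n)\<close> would be 1 rather than 0 for \<open>k < n\<close>.\<close>

definition binom :: "nat \<Rightarrow> int \<Rightarrow> nat" where
  "binom a b = (if b < 0 then 0 else a choose nat b)"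

end

theory Submission
  imports Defs "HOL-Computational_Algebra.Formal_Power_Series"
begin

text \<open>
  Split a permutation at its minimum, \<open>\<pi> = \<alpha> l \<beta>\<close>. It is Jacobi iff \<open>\<alpha>\<close> and \<open>\<beta>\<close> are Jacobi and
  \<open>\<beta>\<close> has even length; it avoids 213 (312) iff \<open>\<alpha>\<close> and \<open>\<beta>\<close> do and all letters of \<open>\<alpha>\<close> are larger
  (smaller) than all letters of \<open>\<beta>\<close>. The only new descent is the one at \<open>l\<close>, if \<open>\<alpha>\<close> is nonempty.
  So for both patterns the series \<open>E(z) = \<Sum> W\<^sub>2\<^sub>n z\<^sup>n\<close> and \<open>P(z) = \<Sum> W\<^sub>2\<^sub>n\<^sub>+\<^sub>1 z\<^sup>n\<close>, where \<open>W\<^sub>m\<close> is the sum of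
  \<open>t\<close> to the number of descents, satisfy \<open>E = 1 + t z P E\<close> and \<open>P = (1 + t (E - 1)) E\<close>. With
  \<open>u = E - 1\<close> this says \<open>u = z \<phi>(u)\<close> for \<open>\<phi>(u) = t (1 + u)\<^sup>2 (1 + t u)\<close> and
  \<open>t z P = u / (1 + u)\<close>, and Lagrange inversion yields both formulas.
\<close>

section \<open>Lagrange inversion\<close>

unbundle fps_syntax

text \<open>As \<open>b\<close> has no constant term, \<open>b ^ i\<close> starts in degree
  \<open>i\<close>. The inner sum may therefore run up to \<open>n\<close> for every degree
  \<open>j \<le> n\<close>, and the two sums can be exchanged.\<close>

lemma fps_compose_times_nth:
  fixes a b c :: "'a::comm_ring_1 fps"
  assumes "b $ 0 = 0"
  shows "((a oo b) * c) $ n = (\<Sum>i\<le>n. a $ i * (b ^ i * c) $ n)"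
proof -
  have comp: "(a oo b) $ j = (\<Sum>i\<le>n. a $ i * (b ^ i) $ j)" if "j \<le> n" for j
    unfolding fps_compose_nth
    by (rule sum.mono_neutral_left) (use that assms in \<open>auto simp: startsby_zero_power_prefix\<close>)
  have "((a oo b) * c) $ n = (\<Sum>j\<le>n. (\<Sum>i\<le>n. a $ i * (b ^ i) $ j) * c $ (n - j))"
    unfolding fps_mult_nth atLeast0AtMost by (intro sum.cong) (auto simp: comp)
  also have "\<dots> = (\<Sum>i\<le>n. \<Sum>j\<le>n. a $ i * (b ^ i) $ j * c $ (n - j))"
    unfolding sum_distrib_right by (rule sum.swap)
  also have "\<dots> = (\<Sum>i\<le>n. a $ i * (b ^ i * c) $ n)"
    unfolding fps_mult_nth atLeast0AtMost by (simp add: sum_distrib_left mult.assoc)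
  finally show ?thesis .
qed

text \<open>The left-hand side is the residue of \<open>G\<^sup>i\<^sup>-\<^sup>n\<^sup>-\<^sup>1 G'\<close>, hence vanishes
  unless the exponent is \<open>-1\<close>.\<close>

lemma lagrange_residue:
  fixes \<phi> :: "'a::field_char_0 fps"
  assumes "\<phi> $ 0 \<noteq> 0" "i \<le> n"
  defines "G \<equiv> fps_X * inverse \<phi>"
  shows "(G ^ i * (fps_deriv G * \<phi> ^ Suc n)) $ n = (if i = n then 1 else 0)"
proof -
  define \<psi> where "\<psi> = inverse \<phi>"
  define k where "k = n - i"
  have n: "n = i + k" using assms by (simp add: k_def)
  have inv: "\<psi> * \<phi> = 1" unfolding \<psi>_def using assms by (simp add: inverse_mult_eq_1)
  have inv_pow: "\<psi> ^ i * \<phi> ^ i = 1" by (simp add: inv flip: power_mult_distrib)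
  have deriv_psi: "fps_deriv \<psi> = - fps_deriv \<phi> * \<psi>\<^sup>2"
    unfolding \<psi>_def using assms by (simp add: fps_inverse_deriv)
  have "G ^ i * (fps_deriv G * \<phi> ^ Suc n)
      = fps_X ^ i * ((\<psi> ^ i * \<phi> ^ i) * ((\<psi> + fps_X * fps_deriv \<psi>) * \<phi> * \<phi> ^ k))"
    by (simp add: G_def \<psi>_def[symmetric] n power_add power_mult_distrib algebra_simps)
  also have "\<dots> = fps_X ^ i * ((\<psi> * \<phi>) * \<phi> ^ k - fps_X * fps_deriv \<phi> * (\<psi> * \<phi>) * \<psi> * \<phi> ^ k)"
    unfolding inv_pow deriv_psi by (simp add: power2_eq_square algebra_simps)
  also have "\<dots> = fps_X ^ i * (\<phi> ^ k - fps_X * (fps_deriv \<phi> * \<psi> * \<phi> ^ k))"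
    by (simp add: inv mult.assoc)
  finally have *: "(G ^ i * (fps_deriv G * \<phi> ^ Suc n)) $ n
      = (\<phi> ^ k - fps_X * (fps_deriv \<phi> * \<psi> * \<phi> ^ k)) $ k"
    by (simp add: fps_X_power_mult_nth n)
  show ?thesis
  proof (cases k)
    case 0
    then show ?thesis using * n by simp
  next
    case (Suc r)
    have "fps_deriv \<phi> * \<psi> * \<phi> ^ k = fps_deriv \<phi> * \<phi> ^ r * (\<psi> * \<phi>)"
      by (simp add: Suc algebra_simps)
    also have "\<dots> = fps_deriv \<phi> * \<phi> ^ r" by (simp add: inv)
    finally have e: "fps_deriv \<phi> * \<psi> * \<phi> ^ k = fps_deriv \<phi> * \<phi> ^ r" .
    \<comment> \<open>The two terms of the difference in \<open>*\<close> cancel: \<open>k\<close>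
      times \<open>fps_deriv \<phi> * \<phi> ^ r\<close> is the derivative of
      \<open>\<phi> ^ k\<close>, and characteristic 0 permits dividing by \<open>k\<close>.\<close>
    have "of_nat k * (fps_deriv \<phi> * \<phi> ^ r) $ r = (fps_deriv (\<phi> ^ k)) $ r"
      by (simp add: fps_deriv_power Suc mult.assoc del: of_nat_Suc power_Suc)
    also have "\<dots> = of_nat k * (\<phi> ^ k) $ k" by (simp add: Suc del: power_Suc)
    finally have "(fps_deriv \<phi> * \<phi> ^ r) $ r = (\<phi> ^ k) $ k" using Suc
      by (simp del: of_nat_Suc power_Suc)
    then show ?thesis using *[unfolded e] n by (simp add: Suc del: power_Suc)
  qed
qed

text \<open>The equation makes \<open>u\<close> the compositional inverse of
  \<open>G = X / \<phi>\<close>. After differentiating \<open>(H oo u) oo G = H\<close> and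
  expanding the outer derivative in powers of \<open>G\<close>, the residue lemma leaves only the
  term of index \<open>n\<close>.\<close>

lemma fps_lagrange_inversion:
  fixes \<phi> u H :: "'a::field_char_0 fps"
  assumes phi0: "\<phi> $ 0 \<noteq> 0" and u: "u = fps_X * (\<phi> oo u)"
  shows "of_nat (Suc n) * (H oo u) $ Suc n = (fps_deriv H * \<phi> ^ Suc n) $ n"
proof -
  define G where "G = fps_X * inverse \<phi>"
  have u0: "u $ 0 = 0" by (subst u) simp
  have G0: "G $ 0 = 0" and G1: "G $ 1 \<noteq> 0" using phi0 by (simp_all add: G_def)
  have "G oo u = u * inverse (\<phi> oo u)"
    using u0 phi0 by (simp add: G_def fps_compose_mult_distrib fps_inverse_compose)
  also have "\<dots> = fps_X * ((\<phi> oo u) * inverse (\<phi> oo u))"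
    by (subst u) (simp add: mult.assoc)
  also have "\<dots> = fps_X" using phi0 by (simp add: inverse_mult_eq_1')
  finally have Gu: "G oo u = fps_X" .
  have "u = (fps_inv G oo G) oo u" using u0 G0 G1 by (simp add: fps_inv)
  also have "\<dots> = fps_inv G oo (G oo u)" using u0 G0 by (simp add: fps_compose_assoc)
  finally have "u = fps_inv G" by (simp add: Gu)
  then have uG: "u oo G = fps_X" using fps_inv[OF G0 G1] by simp
  have HG: "(H oo u) oo G = H"
    using u0 G0 by (simp add: uG flip: fps_compose_assoc)
  have "fps_deriv H = (fps_deriv (H oo u) oo G) * fps_deriv G"
    using fps_compose_deriv[OF G0, of "H oo u"] by (simp add: HG)
  then have "(fps_deriv H * \<phi> ^ Suc n) $ n
      = ((fps_deriv (H oo u) oo G) * (fps_deriv G * \<phi> ^ Suc n)) $ n"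
    by (simp add: mult.assoc)
  also have "\<dots> = (\<Sum>i\<le>n. if i = n then fps_deriv (H oo u) $ i else 0)"
    unfolding fps_compose_times_nth[OF G0]
    by (intro sum.cong refl)
      (auto simp: G_def lagrange_residue[OF phi0] simp del: fps_deriv_nth fps_deriv_mult power_Suc)
  also have "\<dots> = fps_deriv (H oo u) $ n" by (simp del: fps_deriv_nth)
  also have "\<dots> = of_nat (Suc n) * (H oo u) $ Suc n" by (simp del: of_nat_Suc)
  finally show ?thesis by simp
qed

lemma fps_one_plus_const_X_power_nth:
  fixes c :: "'a::comm_ring_1"
  shows "(1 + fps_const c * fps_X) ^ n $ i = of_nat (n choose i) * c ^ i"
proof -
  have "(1 + fps_const c * fps_X) ^ n = (\<Sum>k\<le>n. of_nat (n choose k) * (fps_const c * fps_X) ^ k)"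
    using binomial_ring[of "fps_const c * fps_X" 1 n] by (simp add: add.commute)
  also have "\<dots> $ i = (\<Sum>k\<le>n. of_nat (n choose k) * c ^ k * (if i = k then 1 else 0))"
    unfolding fps_sum_nth
    by (intro sum.cong refl)
      (simp add: power_mult_distrib fps_of_nat[symmetric] fps_const_power mult.assoc)
  also have "\<dots> = (if i \<le> n then of_nat (n choose i) * c ^ i else 0)"
    by (subst sum.cong[OF refl, of _ _ "\<lambda>k. if k = i then of_nat (n choose i) * c ^ i else 0"]) auto
  also have "\<dots> = of_nat (n choose i) * c ^ i" by (simp add: binomial_eq_0)
  finally show ?thesis .
qed

lemma binomial_product_nth:
  fixes t :: "'a::comm_ring_1"
  shows "((1 + fps_X) ^ a * (1 + fps_const t * fps_X) ^ b) $ n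
    = (\<Sum>i\<le>n. of_nat (b choose i) * of_nat (a choose (n - i)) * t ^ i)"
proof -
  have "(1 + fps_X) ^ a $ i = (of_nat (a choose i) :: 'a)" for i
    using fps_one_plus_const_X_power_nth[of 1 a i] by simp
  then show ?thesis
    by (subst mult.commute[of "(1 + fps_X) ^ a"])
      (simp only: fps_mult_nth atLeast0AtMost fps_one_plus_const_X_power_nth, simp only: mult_ac)
qed

section \<open>Coefficients determined by the two functional equations\<close>

context
  fixes E P :: "real fps" and t :: real
  assumes t: "t \<noteq> 0"
    and E: "E = 1 + fps_const t * fps_X * P * E"
    and P: "P = (1 + fps_const t * (E - 1)) * E"
begin

definition even_kernel :: "real fps" where
  "even_kernel = fps_const t * ((1 + fps_X) ^ 2 * (1 + fps_const t * fps_X))"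

lemma even_gf_nth_0: "E $ 0 = 1"
  by (subst E) (simp add: mult.assoc mult.left_commute[of _ fps_X])

text \<open>Substituting the equation for \<open>P\<close> into the one for \<open>E\<close>
  eliminates \<open>P\<close>: \<open>t P E = t E^2 (1 + t (E - 1))\<close>, which is
  \<open>even_kernel\<close> evaluated at \<open>E - 1\<close>.\<close>

lemma even_gf_lagrange_equation: "E - 1 = fps_X * (even_kernel oo (E - 1))"
proof -
  have "(E - 1) $ 0 = 0" by (simp add: even_gf_nth_0)
  then have "even_kernel oo (E - 1) = fps_const t * (E\<^sup>2 * (1 + fps_const t * (E - 1)))"
    by (simp add: even_kernel_def fps_compose_mult_distrib fps_compose_add_distrib power2_eq_square)
  also have "\<dots> = fps_const t * P * E" by (subst P) (simp add: power2_eq_square algebra_simps)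
  finally have "even_kernel oo (E - 1) = fps_const t * P * E" .
  moreover have "E - 1 = fps_X * (fps_const t * P * E)" using E by (simp add: algebra_simps)
  ultimately show ?thesis by metis
qed

lemma even_kernel_power: "even_kernel ^ n = fps_const (t ^ n) * ((1 + fps_X) ^ (2 * n) * (1 + fps_const t * fps_X) ^ n)"
  by (simp add: even_kernel_def power_mult_distrib fps_const_power power_mult)

text \<open>Lagrange inversion with \<open>H = X\<close>: the derivative is 1, so only the power of
  the kernel remains.\<close>

lemma even_gf_nth_Suc:
  "real (Suc n) * E $ Suc n
    = (\<Sum>i\<le>n. real (Suc n choose i) * real (2 * Suc n choose (n - i)) * t ^ (Suc n + i))"
proof -
  \<comment> \<open>The constant term of the kernel is \<open>t\<close>; this is where
    \<open>t \<noteq> 0\<close> enters.\<close>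
  have "even_kernel $ 0 \<noteq> 0" using t by (simp add: even_kernel_def)
  from fps_lagrange_inversion[OF this even_gf_lagrange_equation, of n fps_X]
  have "real (Suc n) * E $ Suc n = (even_kernel ^ Suc n) $ n"
    by (simp add: even_gf_nth_0 del: of_nat_Suc power_Suc)
  then show ?thesis
    by (simp only: even_kernel_power fps_mult_left_const_nth binomial_product_nth)
      (simp only: sum_distrib_left power_add mult_ac)
qed

text \<open>Lagrange inversion with \<open>H = X / (1 + X)\<close>, which sends \<open>E - 1\<close>
  to \<open>X * t * P\<close>; the factor \<open>X\<close> turns index \<open>Suc n\<close> into
  \<open>n\<close>. The derivative \<open>(1 + X)^(-2)\<close> lowers the exponent
  \<open>2 * Suc n\<close> of \<open>1 + X\<close> to \<open>2 * n\<close>.\<close>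

lemma odd_gf_nth:
  "real (Suc n) * P $ n
    = (\<Sum>i\<le>n. real (Suc n choose i) * real (2 * n choose (n - i)) * t ^ (n + i))"
proof -
  define H :: "real fps" where "H = 1 - inverse (1 + fps_X)"
  have inv: "(1 + fps_X) * inverse (1 + fps_X) = (1 :: real fps)"
    by (rule inverse_mult_eq_1') simp
  have deriv: "fps_deriv H = inverse (1 + fps_X) ^ 2"
    by (simp add: H_def fps_inverse_deriv)
  have E0: "(E - 1) $ 0 = 0" by (simp add: even_gf_nth_0)
  have "H oo (E - 1) = 1 - inverse E"
    using E0 by (simp add: H_def fps_compose_sub_distrib fps_inverse_compose fps_compose_add_distrib)
  also have "\<dots> = (E - 1) * inverse E"
    using inverse_mult_eq_1'[of E] by (simp add: even_gf_nth_0 algebra_simps)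
  also have "\<dots> = fps_const t * fps_X * P * (E * inverse E)"
    by (subst E) (simp add: algebra_simps)
  also have "\<dots> = fps_X * (fps_const t * P)"
    using inverse_mult_eq_1'[of E] by (simp add: even_gf_nth_0 algebra_simps)
  finally have H: "H oo (E - 1) = fps_X * (fps_const t * P)" .
  have "fps_deriv H * even_kernel ^ Suc n
      = fps_const (t ^ Suc n) * (((1 + fps_X) * inverse (1 + fps_X)) ^ 2
          * ((1 + fps_X) ^ (2 * n) * (1 + fps_const t * fps_X) ^ Suc n))"
    by (simp only: deriv even_kernel_power power_mult_distrib power_add mult_Suc_right)
      (simp only: mult_ac)
  also have "\<dots> = fps_const (t ^ Suc n) * ((1 + fps_X) ^ (2 * n) * (1 + fps_const t * fps_X) ^ Suc n)"
    by (simp only: inv power_one mult_1)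
  finally have d: "fps_deriv H * even_kernel ^ Suc n = \<dots>" .
  have "even_kernel $ 0 \<noteq> 0" using t by (simp add: even_kernel_def)
  from fps_lagrange_inversion[OF this even_gf_lagrange_equation, of n H]
  have "t * (real (Suc n) * P $ n) = t * (\<Sum>i\<le>n. real (Suc n choose i) * real (2 * n choose (n - i)) * t ^ (n + i))"
    unfolding H d fps_mult_left_const_nth binomial_product_nth
    by (simp add: sum_distrib_left power_add mult_ac
        del: of_nat_Suc binomial_Suc_Suc mult_Suc_right)
  then show ?thesis using t by simp
qed

end

section \<open>Decomposition at the minimum\<close>

text \<open>Ranks grow weakly with the letters, so a strictly smaller rank comes from a strictly
  smaller letter. One rule serves both patterns.\<close>

lemma standardize_eq_3E:
  assumes "standardize w = [a, b, c]"
  obtains x y z where "w = [x, y, z]"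
    "a < b \<Longrightarrow> x < y" "b < a \<Longrightarrow> y < x" "a < c \<Longrightarrow> x < z" "c < a \<Longrightarrow> z < x" "b < c \<Longrightarrow> y < z"
proof -
  define s where "s x = card {y \<in> set w. y \<le> x}" for x
  have mono: "x < y" if "s x < s y" for x y
  proof (rule ccontr)
    assume "\<not> x < y"
    then have "s y \<le> s x" unfolding s_def by (intro card_mono) auto
    then show False using that by simp
  qed
  have "map s w = [a, b, c]" using assms unfolding standardize_def s_def .
  then obtain x y z where "w = [x, y, z]" "s x = a" "s y = b" "s z = c"
    by (auto simp: map_eq_Cons_conv)
  then show ?thesis using mono that[of x y z] by auto
qed

lemma avoids_213_iff:
  "avoids \<pi> [2, 1, 3] \<longleftrightarrow> (\<forall>x y z. subseq [x, y, z] \<pi> \<longrightarrow> \<not> (y < x \<and> x < z))"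
proof -
  have "standardize [x, y, z] = [2, 1, 3]" if "y < x" "x < z" for x y z
  proof -
    have "{v \<in> set [x, y, z]. v \<le> x} = {x, y}" "{v \<in> set [x, y, z]. v \<le> y} = {y}"
      "{v \<in> set [x, y, z]. v \<le> z} = {x, y, z}" using that by auto
    then show ?thesis using that unfolding standardize_def by simp
  qed
  moreover have "\<exists>x y z. w = [x, y, z] \<and> y < x \<and> x < z" if "standardize w = [2, 1, 3]" for w
    using that by (rule standardize_eq_3E) auto
  ultimately show ?thesis unfolding avoids_def by blast
qed

lemma avoids_312_iff:
  "avoids \<pi> [3, 1, 2] \<longleftrightarrow> (\<forall>x y z. subseq [x, y, z] \<pi> \<longrightarrow> \<not> (y < z \<and> z < x))"
proof -
  have "standardize [x, y, z] = [3, 1, 2]" if "y < z" "z < x" for x y z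
  proof -
    have "{v \<in> set [x, y, z]. v \<le> x} = {x, y, z}" "{v \<in> set [x, y, z]. v \<le> y} = {y}"
      "{v \<in> set [x, y, z]. v \<le> z} = {y, z}" using that by auto
    then show ?thesis using that unfolding standardize_def by simp
  qed
  moreover have "\<exists>x y z. w = [x, y, z] \<and> y < z \<and> z < x" if "standardize w = [3, 1, 2]" for w
    using that by (rule standardize_eq_3E) auto
  ultimately show ?thesis unfolding avoids_def by blast
qed

lemma subseq_imp_set_subset: "subseq xs ys \<Longrightarrow> set xs \<subseteq> set ys"
  by (induction rule: list_emb.induct) auto

lemma avoids_subseq: "avoids \<pi> \<sigma> \<Longrightarrow> subseq \<tau> \<pi> \<Longrightarrow> avoids \<tau> \<sigma>"
  unfolding avoids_def using subseq_order.order_trans by blast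

lemma avoids_append_ConsD:
  assumes "avoids (\<alpha> @ l # \<beta>) \<sigma>"
  shows "avoids \<alpha> \<sigma>" "avoids \<beta> \<sigma>"
proof -
  have "subseq \<alpha> (\<alpha> @ l # \<beta>)" "subseq \<beta> (\<alpha> @ l # \<beta>)"
    using subseq_rev_drop_many[of \<alpha> \<alpha> "l # \<beta>"] subseq_drop_many[of \<beta> \<beta> "\<alpha> @ [l]"] by simp_all
  then show "avoids \<alpha> \<sigma>" "avoids \<beta> \<sigma>" using assms avoids_subseq by blast+
qed

text \<open>If the cut leaves letters on both sides, then \<open>x\<close> lies on the left and
  \<open>z\<close> on the right, wherever \<open>y\<close> falls.\<close>

lemma subseq_3_appendE:
  assumes "subseq [x, y, z] (\<alpha> @ \<beta>)"
  obtains "subseq [x, y, z] \<alpha>" | "x \<in> set \<alpha>" "z \<in> set \<beta>" | "subseq [x, y, z] \<beta>"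
proof -
  obtain us vs where *: "[x, y, z] = us @ vs" "subseq us \<alpha>" "subseq vs \<beta>"
    using assms by (metis subseq_appendE)
  have "set us \<subseteq> set \<alpha>" "set vs \<subseteq> set \<beta>" using * by (simp_all add: subseq_imp_set_subset)
  then show ?thesis using * that
    by (cases us; cases vs rule: rev_cases) (auto simp: Cons_eq_append_conv append_eq_Cons_conv)
qed

text \<open>When \<open>l\<close> is the minimum, it plays the 1 of either pattern between
  \<open>a\<close> and \<open>b\<close>; avoidance then dictates the order of \<open>a\<close> and
  \<open>b\<close>.\<close>

lemma subseq_3_appendI:
  assumes "a \<in> set \<alpha>" "b \<in> set \<beta>"
  shows "subseq [a, l, b] (\<alpha> @ l # \<beta>)"
proof -
  have "subseq [a] \<alpha>" "subseq [b] \<beta>" using assms by (simp_all add: subseq_singleton_left)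
  then have "subseq ([a] @ [l, b]) (\<alpha> @ l # \<beta>)" by (intro list_emb_append_mono) auto
  then show ?thesis by simp
qed

section \<open>Avoidance and the Jacobi property under splitting at the minimum\<close>

context
  fixes l :: nat and \<alpha> \<beta> :: "nat list"
  assumes min: "\<forall>x\<in>set \<alpha> \<union> set \<beta>. l < x"
begin

text \<open>A pair \<open>a < b\<close> across \<open>l\<close> would give the occurrence
  \<open>a l b\<close>. Conversely, an occurrence cannot straddle the cut, since no letter right of
  it exceeds a letter of \<open>\<alpha>\<close>, and it cannot begin with \<open>l\<close>, since
  its first letter is not its smallest.\<close>

lemma avoids_213_append:
  assumes "set \<alpha> \<inter> set \<beta> = {}"
  shows "avoids (\<alpha> @ l # \<beta>) [2, 1, 3]
    \<longleftrightarrow> avoids \<alpha> [2, 1, 3] \<and> avoids \<beta> [2, 1, 3] \<and> (\<forall>a\<in>set \<alpha>. \<forall>b\<in>set \<beta>. b < a)"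
    (is "?L \<longleftrightarrow> ?R")
proof
  assume L: ?L
  have "b < a" if "a \<in> set \<alpha>" "b \<in> set \<beta>" for a b
  proof -
    have "\<not> (l < a \<and> a < b)"
      using L subseq_3_appendI[OF that, of l] by (metis avoids_213_iff)
    moreover have "l < a" "a \<noteq> b" using min that assms by auto
    ultimately show ?thesis by simp
  qed
  moreover have "avoids \<alpha> [2, 1, 3]" "avoids \<beta> [2, 1, 3]"
    using avoids_append_ConsD[OF L] by simp_all
  ultimately show ?R by blast
next
  assume R: ?R
  show ?L unfolding avoids_213_iff
  proof (intro allI impI notI, elim conjE)
    fix x y z assume *: "subseq [x, y, z] (\<alpha> @ l # \<beta>)" "y < x" "x < z"
    from *(1) show False
    proof (cases rule: subseq_3_appendE)
      case 1
      then show False using R * by (metis avoids_213_iff)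
    next
      case 2
      then have "z = l \<or> z < x" using R by auto
      moreover have "l < x" using 2 min by blast
      ultimately show False using *(3) by auto
    next
      case 3
      have "y \<in> set (l # \<beta>)" using subseq_imp_set_subset[OF 3] by simp
      then have "l \<le> y" using min by (auto intro: less_imp_le)
      then have "l \<noteq> x" using * by simp
      then have "subseq [x, y, z] \<beta>" using 3 by (auto simp: subseq_Cons2_neq)
      then show False using R * by (metis avoids_213_iff)
    qed
  qed
qed

text \<open>A pair \<open>a > b\<close> across \<open>l\<close> would give the occurrence
  \<open>a l b\<close>. Conversely, the minimum \<open>l\<close> can be neither the 3 nor the 2 of
  an occurrence, and a straddling one would need a letter of \<open>\<alpha>\<close> above a letter
  of \<open>\<beta>\<close>.\<close>

lemma avoids_312_append:
  assumes "set \<alpha> \<inter> set \<beta> = {}"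
  shows "avoids (\<alpha> @ l # \<beta>) [3, 1, 2]
    \<longleftrightarrow> avoids \<alpha> [3, 1, 2] \<and> avoids \<beta> [3, 1, 2] \<and> (\<forall>a\<in>set \<alpha>. \<forall>b\<in>set \<beta>. a < b)"
    (is "?L \<longleftrightarrow> ?R")
proof
  assume L: ?L
  have "a < b" if "a \<in> set \<alpha>" "b \<in> set \<beta>" for a b
  proof -
    have "\<not> (l < b \<and> b < a)"
      using L subseq_3_appendI[OF that, of l] by (metis avoids_312_iff)
    moreover have "l < b" "a \<noteq> b" using min that assms by auto
    ultimately show ?thesis by simp
  qed
  moreover have "avoids \<alpha> [3, 1, 2]" "avoids \<beta> [3, 1, 2]"
    using avoids_append_ConsD[OF L] by simp_all
  ultimately show ?R by blast
next
  assume R: ?R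
  show ?L unfolding avoids_312_iff
  proof (intro allI impI notI, elim conjE)
    fix x y z assume *: "subseq [x, y, z] (\<alpha> @ l # \<beta>)" "y < z" "z < x"
    have "y \<in> set (\<alpha> @ l # \<beta>)" using subseq_imp_set_subset[OF *(1)] by simp
    then have "l \<le> y" using min by (auto intro: less_imp_le)
    then have "z \<noteq> l" "x \<noteq> l" using * by simp_all
    from *(1) show False
    proof (cases rule: subseq_3_appendE)
      case 1
      then show False using R * by (metis avoids_312_iff)
    next
      case 2
      then have "x < z" using R \<open>z \<noteq> l\<close> by simp
      then show False using *(3) by simp
    next
      case 3
      then have "subseq [x, y, z] \<beta>" using \<open>x \<noteq> l\<close> by (auto simp: subseq_Cons2_neq)
      then show False using R * by (metis avoids_312_iff)
    qed
  qed
qed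

text \<open>The run after a letter of \<open>\<alpha>\<close> stops at \<open>l\<close> at the
  latest, the run after \<open>l\<close> is all of \<open>\<beta>\<close>, and runs inside
  \<open>\<beta>\<close> do not see what precedes.\<close>

lemma jacobi_append:
  assumes "distinct \<alpha>" "distinct \<beta>" "set \<alpha> \<inter> set \<beta> = {}"
  shows "jacobi (\<alpha> @ l # \<beta>) \<longleftrightarrow> jacobi \<alpha> \<and> jacobi \<beta> \<and> even (length \<beta>)"
proof -
  have "rho (\<alpha> @ l # \<beta>) x = rho \<alpha> x" if "x \<in> set \<alpha>" for x
  proof -
    obtain \<gamma> \<delta> where "\<alpha> = \<gamma> @ x # \<delta>" "x \<notin> set \<gamma>" using split_list_first \<open>x \<in> set \<alpha>\<close> by metis
    moreover have "dropWhile (\<lambda>y. y \<noteq> x) (\<gamma> @ x # \<zeta>) = x # \<zeta>" for \<zeta>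
      using \<open>x \<notin> set \<gamma>\<close> by (subst dropWhile_append2) auto
    moreover have "takeWhile (\<lambda>y. y > x) (\<delta> @ l # \<beta>) = takeWhile (\<lambda>y. y > x) \<delta>"
      using bspec[OF min, of x] that by (subst takeWhile_tail) auto
    ultimately show ?thesis by (simp add: rho_def)
  qed
  moreover have "rho (\<alpha> @ l # \<beta>) l = \<beta>"
  proof -
    have "dropWhile (\<lambda>y. y \<noteq> l) (\<alpha> @ l # \<beta>) = l # \<beta>"
      using min by (subst dropWhile_append2) auto
    then show ?thesis using min by (simp add: rho_def takeWhile_eq_all_conv)
  qed
  moreover have "rho (\<alpha> @ l # \<beta>) x = rho \<beta> x" if "x \<in> set \<beta>" for x
  proof -
    have "dropWhile (\<lambda>y. y \<noteq> x) (\<alpha> @ l # \<beta>) = dropWhile (\<lambda>y. y \<noteq> x) (l # \<beta>)"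
      using that assms by (subst dropWhile_append2) auto
    then show ?thesis using that min by (auto simp: rho_def)
  qed
  ultimately show ?thesis unfolding jacobi_def by (auto simp: ball_Un cong: ball_cong)
qed

end

section \<open>Descents under splitting at the minimum\<close>

lemma des_Nil [simp]: "des [] = 0" and des_singleton [simp]: "des [x] = 0"
  by (simp_all add: des_def)

text \<open>Prefixing a letter shifts all descents by one, and index 1 records the comparison of
  \<open>x\<close> with \<open>y\<close>.\<close>

lemma des_Cons_Cons [simp]: "des (x # y # \<pi>) = (if y < x then 1 else 0) + des (y # \<pi>)"
proof -
  let ?D = "{i \<in> {1..<length (y # \<pi>)}. (y # \<pi>) ! (i - 1) > (y # \<pi>) ! i}"
  have "{i \<in> {1..<length (x # y # \<pi>)}. (x # y # \<pi>) ! (i - 1) > (x # y # \<pi>) ! i}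
      = (if y < x then {1} else {}) \<union> Suc ` ?D" (is "?L = ?R")
  proof (rule set_eqI)
    fix i
    show "i \<in> ?L \<longleftrightarrow> i \<in> ?R"
    proof (cases i)
      case (Suc j)
      then show ?thesis by (cases j) (auto simp: image_iff)
    qed auto
  qed
  then have "des (x # y # \<pi>) = card ((if y < x then {1} else {}) \<union> Suc ` ?D)"
    by (simp add: des_def)
  also have "\<dots> = (if y < x then 1 else 0) + card (Suc ` ?D)"
    by (subst card_Un_disjoint) auto
  also have "card (Suc ` ?D) = des (y # \<pi>)"
    unfolding des_def by (rule card_image) simp
  finally show ?thesis .
qed

text \<open>The step into \<open>l\<close> is a descent whenever there is one, and the step out of
  \<open>l\<close> is always an ascent.\<close>

lemma des_append:
  assumes "\<forall>x\<in>set \<alpha> \<union> set \<beta>. l < x"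
  shows "des (\<alpha> @ l # \<beta>) = des \<alpha> + des \<beta> + (if \<alpha> = [] then 0 else 1)"
  using assms
proof (induction \<alpha> rule: induct_list012)
  case 1
  then show ?case by (cases \<beta>) auto
next
  case (2 x)
  then show ?case by (cases \<beta>) auto
qed auto

lemma partition_interval:
  fixes A B :: "nat set"
  assumes "B \<union> A = {c..<c + m}" "\<forall>a\<in>A. \<forall>b\<in>B. b < a"
  shows "B = {c..<c + card B}" "A = {c + card B..<c + m}"
proof -
  \<comment> \<open>\<open>s\<close> is the cut point between the two blocks; an empty upper block
    puts it at the end of the interval.\<close>
  define s where "s = (if A = {} then c + m else Min A)"
  have fin: "finite A" using assms by (metis finite_Un finite_atLeastLessThan)
  have s: "c \<le> s" "s \<le> c + m"
  proof -
    have "s = c + m \<or> s \<in> B \<union> A" using fin Min_in[of A] by (auto simp: s_def)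
    then show "c \<le> s" "s \<le> c + m" unfolding assms(1) by auto
  qed
  have B: "B = {c..<s}"
  proof (cases "A = {}")
    case False
    then have "s \<in> A" "\<And>a. a \<in> A \<Longrightarrow> s \<le> a" using fin by (auto simp: s_def)
    then show ?thesis using assms s by (fastforce simp: set_eq_iff)
  qed (use assms in \<open>simp add: s_def\<close>)
  then have "card B = s - c" by simp
  moreover have "A = {s..<c + m}"
  proof -
    have "A \<inter> B = {}" using assms(2) by fastforce
    then have "A = (B \<union> A) - B" by blast
    also have "\<dots> = {c..<c + m} - {c..<s}" by (simp only: assms(1) flip: B)
    also have "\<dots> = {s..<c + m}" using s by auto
    finally show ?thesis .
  qed
  ultimately show "B = {c..<c + card B}" "A = {c + card B..<c + m}" using s B by simp_all
qed

text \<open>The starting letter \<open>l\<close> is free because the parts left and right of the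
  minimum fill intervals that start elsewhere.\<close>

definition jac_avoid :: "nat list \<Rightarrow> nat \<Rightarrow> nat \<Rightarrow> nat list set" where
  "jac_avoid \<sigma> l m = {\<pi> \<in> permutations_of_set {l..<l + m}. jacobi \<pi> \<and> avoids \<pi> \<sigma>}"

lemma jac_avoid_iff:
  "\<pi> \<in> jac_avoid \<sigma> l m \<longleftrightarrow> set \<pi> = {l..<l + m} \<and> distinct \<pi> \<and> jacobi \<pi> \<and> avoids \<pi> \<sigma>"
  by (auto simp: jac_avoid_def permutations_of_set_def)

lemma finite_jac_avoid [simp]: "finite (jac_avoid \<sigma> l m)"
  by (simp add: jac_avoid_def)

lemma length_jac_avoid: "\<pi> \<in> jac_avoid \<sigma> l m \<Longrightarrow> length \<pi> = m"
  by (auto simp: jac_avoid_iff dest: distinct_card)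

lemma jac_avoid_0: "jac_avoid \<sigma> l 0 = (if avoids [] \<sigma> then {[]} else {})"
  by (auto simp: jac_avoid_iff jacobi_def)

text \<open>First letters of the intervals filled by the parts left and right of the minimum \<open>l\<close>, the
  other part having length \<open>b\<close> resp. \<open>a\<close>.\<close>

definition left_start :: "nat list \<Rightarrow> nat \<Rightarrow> nat \<Rightarrow> nat" where
  "left_start \<sigma> l b = (if \<sigma> = [2, 1, 3] then Suc l + b else Suc l)"

definition right_start :: "nat list \<Rightarrow> nat \<Rightarrow> nat \<Rightarrow> nat" where
  "right_start \<sigma> l a = (if \<sigma> = [2, 1, 3] then Suc l else Suc l + a)"

lemma set_append_Cons_interval:
  assumes "distinct (\<alpha> @ l # \<beta>)"
  shows "set (\<alpha> @ l # \<beta>) = {l..<l + Suc m} \<longleftrightarrow> set \<beta> \<union> set \<alpha> = {Suc l..<Suc l + m}"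
proof -
  have "{l..<l + Suc m} = insert l {Suc l..<Suc l + m}" by auto
  moreover have "l \<notin> set \<beta> \<union> set \<alpha>" using assms by auto
  moreover have "set (\<alpha> @ l # \<beta>) = insert l (set \<beta> \<union> set \<alpha>)" by auto
  ultimately show ?thesis by (metis atLeastLessThan_iff insert_ident not_less_eq_eq order_refl)
qed

text \<open>\<open>b\<close> is the length of \<open>\<beta>\<close>. Avoidance puts one part
  entirely below the other, so each fills an interval fixed by \<open>b\<close> and the
  pattern.\<close>

lemma jac_avoid_append:
  assumes \<sigma>: "\<sigma> \<in> {[2, 1, 3], [3, 1, 2]}"
  shows "\<alpha> @ l # \<beta> \<in> jac_avoid \<sigma> l (Suc m) \<longleftrightarrow>
    (\<exists>b\<le>m. even b \<and> \<alpha> \<in> jac_avoid \<sigma> (left_start \<sigma> l b) (m - b)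
      \<and> \<beta> \<in> jac_avoid \<sigma> (right_start \<sigma> l (m - b)) b)" (is "?L \<longleftrightarrow> ?R")
proof
  assume L: ?L
  then have d: "distinct (\<alpha> @ l # \<beta>)" unfolding jac_avoid_iff by blast
  then have dist: "distinct \<alpha>" "distinct \<beta>" "set \<alpha> \<inter> set \<beta> = {}" by auto
  have un: "set \<beta> \<union> set \<alpha> = {Suc l..<Suc l + m}"
    using L set_append_Cons_interval[OF d, of m] unfolding jac_avoid_iff by blast
  have min: "\<forall>x\<in>set \<alpha> \<union> set \<beta>. l < x" unfolding Un_commute[of "set \<alpha>"] un by auto
  define b where "b = length \<beta>"
  have cb: "card (set \<beta>) = b" "card (set \<alpha>) = length \<alpha>"
    using dist by (simp_all add: b_def distinct_card)
  have "card (set \<beta> \<union> set \<alpha>) = b + length \<alpha>"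
    using cb dist by (subst card_Un_disjoint) auto
  then have len: "b \<le> m" "length \<alpha> = m - b" by (simp_all add: un)
  have jac: "jacobi \<alpha>" "jacobi \<beta>" "even b"
    using L jacobi_append[OF min] dist by (auto simp: jac_avoid_iff b_def)
  show ?R
  proof (cases "\<sigma> = [2, 1, 3]")
    case True
    then have av: "avoids \<alpha> \<sigma>" "avoids \<beta> \<sigma>" "\<forall>a\<in>set \<alpha>. \<forall>b\<in>set \<beta>. b < a"
      using L avoids_213_append[OF min] dist by (auto simp: jac_avoid_iff)
    show ?thesis
      using partition_interval[OF un av(3), unfolded cb] True len(1) jac av(1,2) dist
      by (auto simp: jac_avoid_iff left_start_def right_start_def intro!: exI[of _ b])
  next
    case False
    then have F: "\<sigma> = [3, 1, 2]" using \<sigma> by simp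
    then have av: "avoids \<alpha> \<sigma>" "avoids \<beta> \<sigma>" "\<forall>b\<in>set \<beta>. \<forall>a\<in>set \<alpha>. a < b"
      using L avoids_312_append[OF min] dist by (auto simp: jac_avoid_iff)
    \<comment> \<open>For 312 the part \<open>\<alpha>\<close> is the lower block, so the roles in
      \<open>partition_interval\<close> are exchanged.\<close>
    have un': "set \<alpha> \<union> set \<beta> = {Suc l..<Suc l + m}" using un by blast
    show ?thesis
      using partition_interval[OF un' av(3), unfolded cb len(2)] False len(1) jac av(1,2) dist
      by (auto simp: jac_avoid_iff left_start_def right_start_def intro!: exI[of _ b])
  qed
next
  assume ?R
  then obtain b where b: "b \<le> m" "even b" "\<alpha> \<in> jac_avoid \<sigma> (left_start \<sigma> l b) (m - b)"
    "\<beta> \<in> jac_avoid \<sigma> (right_start \<sigma> l (m - b)) b" by blast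
  have set: "set \<alpha> = {left_start \<sigma> l b..<left_start \<sigma> l b + (m - b)}"
    "set \<beta> = {right_start \<sigma> l (m - b)..<right_start \<sigma> l (m - b) + b}"
    and dist: "distinct \<alpha>" "distinct \<beta>" and jac: "jacobi \<alpha>" "jacobi \<beta>"
    and av: "avoids \<alpha> \<sigma>" "avoids \<beta> \<sigma>"
    using b by (simp_all add: jac_avoid_iff)
  have un: "set \<beta> \<union> set \<alpha> = {Suc l..<Suc l + m}" and disj: "set \<alpha> \<inter> set \<beta> = {}"
    using b(1) unfolding set left_start_def right_start_def by auto
  have min: "\<forall>x\<in>set \<alpha> \<union> set \<beta>. l < x" unfolding Un_commute[of "set \<alpha>"] un by auto
  have d: "distinct (\<alpha> @ l # \<beta>)" using dist disj min by auto
  have "jacobi (\<alpha> @ l # \<beta>)"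
    using jacobi_append[OF min dist disj] jac b length_jac_avoid by blast
  moreover have "avoids (\<alpha> @ l # \<beta>) \<sigma>"
  proof (cases "\<sigma> = [2, 1, 3]")
    case True
    then have "\<forall>a\<in>set \<alpha>. \<forall>b\<in>set \<beta>. b < a"
      unfolding set left_start_def right_start_def by auto
    then show ?thesis using avoids_213_append[OF min disj] av True by simp
  next
    case False
    then have "\<forall>a\<in>set \<alpha>. \<forall>b\<in>set \<beta>. a < b"
      unfolding set left_start_def right_start_def by auto
    then show ?thesis using avoids_312_append[OF min disj] av False \<sigma> by simp
  qed
  ultimately show ?L
    using set_append_Cons_interval[OF d, of m] un d unfolding jac_avoid_iff by blast
qed

section \<open>Descent polynomials: recursion and generating functions\<close>

definition des_poly :: "nat list \<Rightarrow> real \<Rightarrow> nat \<Rightarrow> nat \<Rightarrow> real" where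
  "des_poly \<sigma> t l m = (\<Sum>\<pi>\<in>jac_avoid \<sigma> l m. t ^ des \<pi>)"

context
  fixes \<sigma> :: "nat list"
  assumes \<sigma>: "\<sigma> \<in> {[2, 1, 3], [3, 1, 2]}"
begin

lemma des_poly_0: "des_poly \<sigma> t l 0 = 1"
proof -
  have "avoids [] \<sigma>" using \<sigma> by (auto simp: avoids_def standardize_def)
  then show ?thesis by (simp add: des_poly_def jac_avoid_0)
qed

text \<open>Splitting at \<open>l\<close> is a bijection onto triples of a length \<open>b\<close>,
  a left part and a right part. The weight is 1 for \<open>b = m\<close> because then the left part
  is empty and \<open>l\<close> creates no descent.\<close>

lemma des_poly_Suc:
  "des_poly \<sigma> t l (Suc m) = (\<Sum>b | b \<le> m \<and> even b. (if b = m then 1 else t)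
    * des_poly \<sigma> t (left_start \<sigma> l b) (m - b) * des_poly \<sigma> t (right_start \<sigma> l (m - b)) b)"
proof -
  define A where "A b = jac_avoid \<sigma> (left_start \<sigma> l b) (m - b)" for b
  define B where "B b = jac_avoid \<sigma> (right_start \<sigma> l (m - b)) b" for b
  define J where "J = {b. b \<le> m \<and> even b}"
  define D where "D = (SIGMA b:J. A b \<times> B b)"
  define join where "join = (\<lambda>(b :: nat, \<alpha>, \<beta>). \<alpha> @ l # \<beta>)"
  have gt: "\<forall>x\<in>set \<alpha> \<union> set \<beta>. l < x" if "(b, \<alpha>, \<beta>) \<in> D" for b \<alpha> \<beta>
    using that by (auto simp: D_def A_def B_def jac_avoid_iff left_start_def right_start_def split: if_splits)
  \<comment> \<open>Neither part contains \<open>l\<close>, so its position determines both parts,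
    and \<open>b\<close> is the length of the right one.\<close>
  have inj: "inj_on join D"
  proof (rule inj_onI)
    fix p q assume pq: "p \<in> D" "q \<in> D" "join p = join q"
    obtain b \<alpha> \<beta> c \<gamma> \<delta> where [simp]: "p = (b, \<alpha>, \<beta>)" "q = (c, \<gamma>, \<delta>)"
      by (metis prod_cases3)
    have "l \<notin> set \<alpha>" "l \<notin> set \<gamma>" "l \<notin> set \<beta>" "l \<notin> set \<delta>" using gt pq by auto
    then have "\<alpha> = \<gamma>" "\<beta> = \<delta>" using pq by (auto simp: join_def append_Cons_eq_iff)
    moreover have "b = length \<beta>" "c = length \<delta>"
      using pq by (auto simp: D_def B_def length_jac_avoid)
    ultimately show "p = q" by simp
  qed
  have img: "join ` D = jac_avoid \<sigma> l (Suc m)"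
  proof (intro set_eqI iffI)
    fix \<pi> assume \<pi>: "\<pi> \<in> jac_avoid \<sigma> l (Suc m)"
    then have "l \<in> set \<pi>" by (simp add: jac_avoid_iff)
    then obtain \<alpha> \<beta> where "\<pi> = \<alpha> @ l # \<beta>" by (meson split_list)
    moreover from this \<pi> obtain b where "(b, \<alpha>, \<beta>) \<in> D"
      using jac_avoid_append[OF \<sigma>] by (auto simp: D_def J_def A_def B_def)
    ultimately show "\<pi> \<in> join ` D" by (force simp: join_def)
  next
    fix \<pi> assume "\<pi> \<in> join ` D"
    then show "\<pi> \<in> jac_avoid \<sigma> l (Suc m)"
      using jac_avoid_append[OF \<sigma>] by (auto simp: D_def J_def A_def B_def join_def)
  qed
  have "des_poly \<sigma> t l (Suc m) = (\<Sum>p\<in>D. t ^ des (join p))"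
    unfolding des_poly_def img[symmetric] by (simp add: sum.reindex[OF inj])
  also have "\<dots> = (\<Sum>(b, \<alpha>, \<beta>)\<in>D. (if b = m then 1 else t) * (t ^ des \<alpha> * t ^ des \<beta>))"
  proof (rule sum.cong[OF refl], clarify)
    fix b \<alpha> \<beta> assume *: "(b, \<alpha>, \<beta>) \<in> D"
    then have "b \<le> m" "length \<alpha> = m - b" by (auto simp: D_def J_def A_def length_jac_avoid)
    then have "\<alpha> = [] \<longleftrightarrow> b = m" by auto
    then show "t ^ des (join (b, \<alpha>, \<beta>)) = (if b = m then 1 else t) * (t ^ des \<alpha> * t ^ des \<beta>)"
      using des_append[OF gt[OF *]] by (simp add: join_def power_add)
  qed
  also have "\<dots> = (\<Sum>b\<in>J. \<Sum>(\<alpha>, \<beta>)\<in>A b \<times> B b. (if b = m then 1 else t) * (t ^ des \<alpha> * t ^ des \<beta>))"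
    unfolding D_def by (subst sum.Sigma) (auto simp: J_def A_def B_def)
  also have "\<dots> = (\<Sum>b\<in>J. (if b = m then 1 else t)
      * des_poly \<sigma> t (left_start \<sigma> l b) (m - b) * des_poly \<sigma> t (right_start \<sigma> l (m - b)) b)"
    unfolding des_poly_def A_def[symmetric] B_def[symmetric] mult.assoc sum_product
    by (simp add: sum_distrib_left sum.cartesian_product case_prod_unfold)
  finally show ?thesis by (simp add: J_def)
qed

text \<open>The recursion uses the starting letter only to choose the starts for shorter lengths, so
  strong induction replaces an explicit relabelling bijection.\<close>

lemma des_poly_shift: "des_poly \<sigma> t l m = des_poly \<sigma> t l' m"
proof (induction m arbitrary: l l' rule: less_induct)
  case (less m)
  show ?case
  proof (cases m)
    case (Suc r)
    show ?thesis unfolding Suc des_poly_Suc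
      by (intro sum.cong refl arg_cong2[of _ _ _ _ "(*)"] less.IH) (auto simp: Suc)
  qed (simp add: des_poly_0)
qed

lemma des_poly_Suc_div2:
  "des_poly \<sigma> t l (Suc m) = (\<Sum>j\<le>m div 2. (if 2 * j = m then 1 else t)
    * des_poly \<sigma> t l (m - 2 * j) * des_poly \<sigma> t l (2 * j))"
proof -
  have "{b. b \<le> m \<and> even b} = (*) 2 ` {..m div 2}"
    by (auto elim!: evenE)
  then show ?thesis unfolding des_poly_Suc
    by (subst sum.reindex_cong[of "(*) 2" "{..m div 2}"]) 
      (auto simp: inj_on_def intro!: sum.cong arg_cong2[of _ _ _ _ "(*)"] des_poly_shift)
qed

text \<open>In even positive length the left part is odd, hence nonempty, and every term carries
  \<open>t\<close>. In odd length it is even and may be empty, which gives the factor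
  \<open>1 + t (E - 1)\<close>.\<close>

lemma des_poly_even_fps:
  fixes t :: real and l :: nat
  defines "E \<equiv> Abs_fps (\<lambda>n. des_poly \<sigma> t l (2 * n))"
    and "P \<equiv> Abs_fps (\<lambda>n. des_poly \<sigma> t l (2 * n + 1))"
  shows "E = 1 + fps_const t * fps_X * P * E" "P = (1 + fps_const t * (E - 1)) * E"
proof -
  show "E = 1 + fps_const t * fps_X * P * E"
  proof (rule fps_ext)
    fix n
    have e: "fps_const t * fps_X * P * E = fps_X * (fps_const t * (E * P))"
      by (simp only: mult_ac)
    show "E $ n = (1 + fps_const t * fps_X * P * E) $ n"
    proof (cases n)
      case 0
      then show ?thesis unfolding e by (simp add: E_def des_poly_0)
    next
      case (Suc r)
      have "E $ n = des_poly \<sigma> t l (Suc (2 * r + 1))" by (simp add: E_def Suc)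
      also have "\<dots> = (\<Sum>j\<le>r. t * (E $ j * P $ (r - j)))"
      proof (subst des_poly_Suc_div2, rule sum.cong)
        fix j assume "j \<in> {..r}"
        then have "2 * r + 1 - 2 * j = 2 * (r - j) + 1" by auto
        moreover have "2 * j \<noteq> 2 * r + 1" by presburger
        ultimately show "(if 2 * j = 2 * r + 1 then 1 else t) * des_poly \<sigma> t l (2 * r + 1 - 2 * j)
            * des_poly \<sigma> t l (2 * j) = t * (E $ j * P $ (r - j))"
          by (simp only: E_def P_def fps_nth_Abs_fps if_False mult_ac)
      qed simp
      also have "\<dots> = (1 + fps_const t * fps_X * P * E) $ n"
        unfolding e by (simp add: Suc fps_mult_nth[of E P] atLeast0AtMost sum_distrib_left)
      finally show ?thesis .
    qed
  qed
  show "P = (1 + fps_const t * (E - 1)) * E"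
  proof (rule fps_ext)
    fix n
    have Q: "(1 + fps_const t * (E - 1)) $ i = (if i = 0 then 1 else t) * E $ i" for i
      by (simp add: E_def des_poly_0)
    have "P $ n = des_poly \<sigma> t l (Suc (2 * n))" by (simp add: P_def)
    also have "\<dots> = (\<Sum>j\<le>n. E $ j * (1 + fps_const t * (E - 1)) $ (n - j))"
    proof (subst des_poly_Suc_div2, rule sum.cong)
      fix j assume "j \<in> {..n}"
      then have "2 * n - 2 * j = 2 * (n - j)" "2 * j = 2 * n \<longleftrightarrow> n - j = 0" by auto
      then show "(if 2 * j = 2 * n then 1 else t) * des_poly \<sigma> t l (2 * n - 2 * j)
          * des_poly \<sigma> t l (2 * j) = E $ j * (1 + fps_const t * (E - 1)) $ (n - j)"
        unfolding Q by (simp only: E_def fps_nth_Abs_fps mult_ac)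
    qed simp
    also have "\<dots> = ((1 + fps_const t * (E - 1)) * E) $ n"
      unfolding mult.commute[of _ E] by (simp only: fps_mult_nth atLeast0AtMost)
    finally show "P $ n = ((1 + fps_const t * (E - 1)) * E) $ n" .
  qed
qed

end

section \<open>Extraction of coefficients\<close>

lemma des_le_length: "des \<pi> \<le> length \<pi>"
proof -
  have "des \<pi> \<le> card {1..<length \<pi>}" unfolding des_def by (intro card_mono) auto
  then show ?thesis by simp
qed

lemma des_poly_eq_sum_jdes:
  assumes "m \<le> M"
  shows "des_poly \<sigma> t 1 m = (\<Sum>k\<le>M. real (jdes \<sigma> m k) * t ^ k)"
proof -
  have "des ` jac_avoid \<sigma> 1 m \<subseteq> {..M}"
    using assms des_le_length length_jac_avoid by (fastforce intro: order_trans)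
  then have "des_poly \<sigma> t 1 m
      = (\<Sum>k\<le>M. \<Sum>\<pi> | \<pi> \<in> jac_avoid \<sigma> 1 m \<and> des \<pi> = k. t ^ des \<pi>)"
    unfolding des_poly_def by (intro sum.group[symmetric]) auto
  also have "\<dots> = (\<Sum>k\<le>M. real (jdes \<sigma> m k) * t ^ k)"
    by (intro sum.cong refl) (simp add: jdes_def jac_avoid_def atLeastLessThanSuc_atLeastAtMost conj_assoc)
  finally show ?thesis .
qed

text \<open>Multiplying both sides by \<open>t\<close> makes them agree at \<open>t = 0\<close> as
  well; \<open>sh c\<close> lists the coefficients after this multiplication.\<close>

lemma polyfun_eq_coeffs_nonzero:
  fixes a b :: "nat \<Rightarrow> real"
  assumes "\<And>t. t \<noteq> 0 \<Longrightarrow> (\<Sum>k\<le>M. a k * t ^ k) = (\<Sum>k\<le>M. b k * t ^ k)" and "k \<le> M"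
  shows "a k = b k"
proof -
  define sh where "sh c k = (case k of 0 \<Rightarrow> 0 | Suc j \<Rightarrow> c j)" for c :: "nat \<Rightarrow> real" and k
  have sh: "(\<Sum>k\<le>Suc M. sh c k * t ^ k) = t * (\<Sum>k\<le>M. c k * t ^ k)" for c t
    by (subst sum.atMost_Suc_shift) (simp add: sh_def sum_distrib_left mult_ac)
  have "\<forall>t. (\<Sum>k\<le>Suc M. sh a k * t ^ k) = (\<Sum>k\<le>Suc M. sh b k * t ^ k)"
    unfolding sh using assms(1) by (metis mult_zero_left)
  then have "\<forall>k\<le>Suc M. sh a k = sh b k" by (simp only: polyfun_eq_coeffs)
  then show ?thesis using \<open>k \<le> M\<close> by (auto dest!: spec[of _ "Suc k"] simp: sh_def)
qed

lemma jdes_eq_shifted_coeff: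
  assumes "\<And>t. t \<noteq> 0 \<Longrightarrow> c * des_poly \<sigma> t 1 m = (\<Sum>i\<le>r. f i * t ^ (s + i))"
  shows "c * real (jdes \<sigma> m k) = (if s \<le> k \<and> k \<le> s + r then f (k - s) else 0)"
proof -
  \<comment> \<open>A common degree bound for both polynomials that also covers the index
    \<open>k\<close>.\<close>
  define M where "M = k + m + s + r"
  define g where "g k = (if s \<le> k \<and> k \<le> s + r then f (k - s) else 0)" for k
  have "(\<Sum>k\<le>M. c * real (jdes \<sigma> m k) * t ^ k) = (\<Sum>k\<le>M. g k * t ^ k)" if "t \<noteq> 0" for t
  proof -
    have "(\<Sum>k\<le>M. c * real (jdes \<sigma> m k) * t ^ k) = c * des_poly \<sigma> t 1 m"
      by (subst des_poly_eq_sum_jdes[of _ M]) (auto simp: M_def sum_distrib_left mult_ac)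
    also have "\<dots> = (\<Sum>i\<in>{0..r}. g (i + s) * t ^ (i + s))"
      unfolding assms[OF that] atLeast0AtMost by (intro sum.cong) (auto simp: g_def add.commute)
    also have "\<dots> = (\<Sum>k\<in>{s..s + r}. g k * t ^ k)"
      using sum.shift_bounds_cl_nat_ivl[of "\<lambda>k. g k * t ^ k" 0 s r] by (simp add: add.commute)
    also have "\<dots> = (\<Sum>k\<le>M. g k * t ^ k)"
      by (rule sum.mono_neutral_left) (auto simp: M_def g_def)
    finally show ?thesis .
  qed
  from polyfun_eq_coeffs_nonzero[OF this, of k] show ?thesis by (simp add: M_def g_def)
qed


theorem theorem4p2:
  fixes \<sigma> :: "nat list"
  assumes "\<sigma> \<in> {[2, 1, 3], [3, 1, 2]}"
  shows "(\<forall>n k :: nat. n \<ge> 1 \<longrightarrow>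
            real (jdes \<sigma> (2 * n) k) =
              1 / real n * real (binom n (int k - int n)) * real (binom (2 * n) (int k + 1)))
       \<and> (\<forall>n k :: nat.
            real (jdes \<sigma> (2 * n + 1) k) =
              1 / real (n + 1) * real (binom (n + 1) (int k - int n)) * real (binom (2 * n) (int k)))"
proof (intro conjI allI impI)
  fix n k :: nat assume "n \<ge> 1"
  then obtain r where r: "n = Suc r" by (cases n) auto
  have "real n * real (jdes \<sigma> (2 * n) k)
    = (if n \<le> k \<and> k \<le> n + r then real (n choose (k - n)) * real (2 * n choose (r - (k - n))) else 0)"
  proof (rule jdes_eq_shifted_coeff)
    fix t :: real assume "t \<noteq> 0"
    from even_gf_nth_Suc[OF this des_poly_even_fps[OF assms, of t 1], of r]
    show "real n * des_poly \<sigma> t 1 (2 * n)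
        = (\<Sum>i\<le>r. real (n choose i) * real (2 * n choose (r - i)) * t ^ (n + i))"
      by (simp only: r fps_nth_Abs_fps)
  qed
  also have "\<dots> = real (binom n (int k - int n)) * real (binom (2 * n) (int k + 1))"
  proof -
    \<comment> \<open>Outside the middle range the product vanishes: for \<open>k < n\<close> the
      lower index \<open>k - n\<close> is negative, and for \<open>k > n + r = 2 * n - 1\<close> the
      lower index \<open>k + 1\<close> exceeds \<open>2 * n\<close>.\<close>
    consider "k < n" | "n \<le> k" "k \<le> n + r" | "n + r < k" by linarith
    then show ?thesis
    proof cases
      case 2
      \<comment> \<open>As \<open>n = Suc r\<close>, the two lower indices add up to
        \<open>2 * n\<close>.\<close>
      have "2 * n choose (r - (k - n)) = 2 * n choose (k + 1)"
        using 2 r by (subst binomial_symmetric) auto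
      then show ?thesis using 2 by (auto simp: binom_def nat_diff_distrib nat_add_distrib)
    qed (auto simp: binom_def r binomial_eq_0 nat_add_distrib)
  qed
  finally show "real (jdes \<sigma> (2 * n) k)
      = 1 / real n * real (binom n (int k - int n)) * real (binom (2 * n) (int k + 1))"
    using \<open>n \<ge> 1\<close> by (simp add: field_simps)
next
  fix n k :: nat
  have "real (Suc n) * real (jdes \<sigma> (2 * n + 1) k)
    = (if n \<le> k \<and> k \<le> n + n then real (Suc n choose (k - n)) * real (2 * n choose (n - (k - n))) else 0)"
  proof (rule jdes_eq_shifted_coeff)
    fix t :: real assume "t \<noteq> 0"
    from odd_gf_nth[OF this des_poly_even_fps[OF assms, of t 1], of n]
    show "real (Suc n) * des_poly \<sigma> t 1 (2 * n + 1)
        = (\<Sum>i\<le>n. real (Suc n choose i) * real (2 * n choose (n - i)) * t ^ (n + i))"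
      by (simp only: fps_nth_Abs_fps)
  qed
  also have "\<dots> = real (binom (n + 1) (int k - int n)) * real (binom (2 * n) (int k))"
  proof -
    \<comment> \<open>Here the upper boundary is \<open>2 * n\<close>, beyond which
      \<open>2 * n choose k\<close> vanishes.\<close>
    consider "k < n" | "n \<le> k" "k \<le> n + n" | "n + n < k" by linarith
    then show ?thesis
    proof cases
      case 2
      have "2 * n choose (n - (k - n)) = 2 * n choose k"
        using 2 by (subst binomial_symmetric) auto
      then show ?thesis using 2
        by (auto simp: binom_def nat_diff_distrib simp del: binomial_Suc_Suc)
    qed (auto simp: binom_def binomial_eq_0)
  qed
  finally show "real (jdes \<sigma> (2 * n + 1) k)
      = 1 / real (n + 1) * real (binom (n + 1) (int k - int n)) * real (binom (2 * n) (int k))"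
    by (simp add: field_simps)
qed

end
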